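(* Let $K$ be a field with $\operatorname{char} K\neq 2$, let $a,b,c\in K$, and let $k>1$ be an integer. (1) If $x\in\mathbb{H}(a,b)$ is a $k$-potent element of the generalized quaternion algebra over $K$, then for each $\varepsilon\in\{\varphi,\rho\}$ the matrix $\varepsilon(x)\in\mathcal{M}_4(K)$ is a $k$-potent matrix. (2) If $x\in\mathbb{O}(a,b,c)$ is a $k$-potent element of the generalized octonion algebra over $K$, then for each $\varepsilon\in\{\Phi,\Psi\}$ the matrix $\varepsilon(x)\in\mathcal{M}_8(K)$ is a $k$-potent matrix.
   Context: An element $x$ of a (power-associative) ring is called $k$-potent, for an integer $k>1$, if $k$ is the smallest integer greater than $1$ such that $x^k=x$. A $k$-potent matrix is a $k$-potent element of the matrix ring. $\mathbb{H}(a,b)$ is the 4-dimensional associative $K$-algebra with basis $\{1,f_1,f_2,f_3\}$, unit $1$, and $f_1^2=a$, $f_2^2=b$, $f_3^2=-ab$, $f_1f_2=f_3=-f_2f_1$, $f_1f_3=af_2=-f_3f_1$, $f_2f_3=-bf_1=-f_3f_2$. For $q=q_0+q_1f_1+q_2f_2+q_3f_3$, $$\varphi(q)=\begin{pmatrix} q_0 & aq_1 & bq_2 & -abq_3 \\ q_1 & q_0 & bq_3 & -bq_2 \\ q_2 & -aq_3 & q_0 & aq_1 \\ q_3 & -q_2 & q_1 & q_0 \end{pmatrix},\qquad \rho(q)=\begin{pmatrix} q_0 & aq_1 & bq_2 & -abq_3 \\ q_1 & q_0 & -bq_3 & bq_2 \\ q_2 & aq_3 & q_0 & -aq_1 \\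 q_3 & q_2 & -q_1 & q_0 \end{pmatrix}.$$ $\mathbb{O}(a,b,c)$ is the 8-dimensional $K$-algebra with basis $\{1,f_1,\dots,f_7\}$, unit $1$, and products $f_if_j$ given by the following rows (row $f_i$ lists $f_if_1,f_if_2,\dots,f_if_7$): $f_1$: $a,\ f_3,\ af_2,\ f_5,\ af_4,\ -f_7,\ -af_6$; $f_2$: $-f_3,\ b,\ -bf_1,\ f_6,\ f_7,\ bf_4,\ bf_5$; $f_3$: $-af_2,\ bf_1,\ -ab,\ f_7,\ af_6,\ -bf_5,\ -abf_4$; $f_4$: $-f_5,\ -f_6,\ -f_7,\ c,\ -cf_1,\ -cf_2,\ -cf_3$; $f_5$: $-af_4,\ -f_7,\ -af_6,\ cf_1,\ -ac,\ cf_3,\ acf_2$; $f_6$: $f_7,\ -bf_4,\ bf_5,\ cf_2,\ -cf_3,\ -bc,\ -bcf_1$; $f_7$: $af_6,\ -bf_5,\ abf_4,\ cf_3,\ -acf_2,\ bcf_1,\ abc$. This algebra is non-associative but alternative and power-associative, so powers are well defined. For $x=x_0+x_1f_1+\dots+x_7f_7$, $$\Phi(x)=\begin{pmatrix} x_0 & ax_1 & bx_2 & -abx_3 & cx_4 & -acx_5 & -bcx_6 & abcx_7 \\ x_1 & x_0 & bx_3 & -bx_2 & cx_5 & -cx_4 & bcx_7 & -bcx_6 \\ x_2 & -ax_3 & x_0 & ax_1 & cx_6 & -acx_7 & -cx_4 & acx_5 \\ x_3 & -x_2 & x_1 & x_0 & cx_7 & -cx_6 & cx_5 & -cx_4 \\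 x_4 & -ax_5 & -bx_6 & abx_7 & x_0 & ax_1 & bx_2 & -abx_3 \\ x_5 & -x_4 & -bx_7 & bx_6 & x_1 & x_0 & -bx_3 & bx_2 \\ x_6 & ax_7 & -x_4 & -ax_5 & x_2 & ax_3 & x_0 & -ax_1 \\ x_7 & x_6 & -x_5 & -x_4 & x_3 & x_2 & -x_1 & x_0 \end{pmatrix}$$ and $$\Psi(x)=\begin{pmatrix} x_0 & ax_1 & bx_2 & -abx_3 & cx_4 & -acx_5 & -bcx_6 & abcx_7 \\ x_1 & x_0 & -bx_3 & bx_2 & -cx_5 & cx_4 & -bcx_7 & bcx_6 \\ x_2 & ax_3 & x_0 & -ax_1 & -cx_6 & acx_7 & cx_4 & -acx_5 \\ x_3 & x_2 & -x_1 & x_0 & -cx_7 & cx_6 & -cx_5 & cx_4 \\ x_4 & ax_5 & bx_6 & -abx_7 & x_0 & -ax_1 & -bx_2 & abx_3 \\ x_5 & x_4 & bx_7 & -bx_6 & -x_1 & x_0 & bx_3 & -bx_2 \\ x_6 & -ax_7 & x_4 & ax_5 & -x_2 & -ax_3 & x_0 & ax_1 \\ x_7 & -x_6 & x_5 & x_4 & -x_3 & -x_2 & x_1 & x_0 \end{pmatrix}.$$ *)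

theory Defs
  imports "Jordan_Normal_Form.Matrix"
begin

text \<open>
  The power \<open>x [^]\<^bsub>R\<^esub> k\<close> is the left-normed one, \<open>x [^]\<^bsub>R\<^esub> Suc n = x [^]\<^bsub>R\<^esub> n \<otimes>\<^bsub>R\<^esub> x\<close>, and is defined for
  every ring record, associative or not. In a power-associative ring the bracketing is irrelevant.
\<close>

definition k_potent :: "('r, 'm) ring_scheme \<Rightarrow> nat \<Rightarrow> 'r \<Rightarrow> bool" where
  "k_potent R k x \<longleftrightarrow>
     x \<in> carrier R \<and> 1 < k \<and> x [^]\<^bsub>R\<^esub> k = x \<and> (\<forall>m. 1 < m \<and> m < k \<longrightarrow> x [^]\<^bsub>R\<^esub> m \<noteq> x)"

text \<open>
  The algebra on \<open>K\<^sup>n\<close> with basis \<open>f\<^sub>i = unit_vec n i\<close> (\<open>i < n\<close>, unit \<open>f\<^sub>0\<close>) whose product is the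
  bilinear extension of \<open>f\<^sub>i f\<^sub>j = T ! i ! j\<close>. Associativity is not required.
\<close>

definition table_algebra :: "nat \<Rightarrow> 'a::field vec list list \<Rightarrow> 'a vec ring" where
  "table_algebra n T =
    \<lparr>carrier = carrier_vec n,
     mult = (\<lambda>x y. vec n (\<lambda>l. \<Sum>i<n. \<Sum>j<n. x $ i * y $ j * (T ! i ! j) $ l)),
     one = unit_vec n 0,
     zero = 0\<^sub>v n,
     add = (+)\<rparr>"

definition quaternion_table :: "'a::field \<Rightarrow> 'a \<Rightarrow> 'a vec list list" where
  "quaternion_table a b = (let f = unit_vec 4 in
    [[f 0, f 1, f 2, f 3],
     [f 1, a \<cdot>\<^sub>v f 0, f 3, a \<cdot>\<^sub>v f 2],
     [f 2, - f 3, b \<cdot>\<^sub>v f 0, (-b) \<cdot>\<^sub>v f 1],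
     [f 3, (-a) \<cdot>\<^sub>v f 2, b \<cdot>\<^sub>v f 1, (-(a*b)) \<cdot>\<^sub>v f 0]])"

definition quaternion_algebra :: "'a::field \<Rightarrow> 'a \<Rightarrow> 'a vec ring" where
  "quaternion_algebra a b = table_algebra 4 (quaternion_table a b)"

definition octonion_table :: "'a::field \<Rightarrow> 'a \<Rightarrow> 'a \<Rightarrow> 'a vec list list" where
  "octonion_table a b c = (let f = unit_vec 8 in
    [[f 0, f 1, f 2, f 3, f 4, f 5, f 6, f 7],
     [f 1, a \<cdot>\<^sub>v f 0, f 3, a \<cdot>\<^sub>v f 2, f 5, a \<cdot>\<^sub>v f 4, - f 7, (-a) \<cdot>\<^sub>v f 6],
     [f 2, - f 3, b \<cdot>\<^sub>v f 0, (-b) \<cdot>\<^sub>v f 1, f 6, f 7, b \<cdot>\<^sub>v f 4, b \<cdot>\<^sub>v f 5],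
     [f 3, (-a) \<cdot>\<^sub>v f 2, b \<cdot>\<^sub>v f 1, (-(a*b)) \<cdot>\<^sub>v f 0, f 7, a \<cdot>\<^sub>v f 6, (-b) \<cdot>\<^sub>v f 5, (-(a*b)) \<cdot>\<^sub>v f 4],
     [f 4, - f 5, - f 6, - f 7, c \<cdot>\<^sub>v f 0, (-c) \<cdot>\<^sub>v f 1, (-c) \<cdot>\<^sub>v f 2, (-c) \<cdot>\<^sub>v f 3],
     [f 5, (-a) \<cdot>\<^sub>v f 4, - f 7, (-a) \<cdot>\<^sub>v f 6, c \<cdot>\<^sub>v f 1, (-(a*c)) \<cdot>\<^sub>v f 0, c \<cdot>\<^sub>v f 3, (a*c) \<cdot>\<^sub>v f 2],
     [f 6, f 7, (-b) \<cdot>\<^sub>v f 4, b \<cdot>\<^sub>v f 5, c \<cdot>\<^sub>v f 2, (-c) \<cdot>\<^sub>v f 3, (-(b*c)) \<cdot>\<^sub>v f 0, (-(b*c)) \<cdot>\<^sub>v f 1],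
     [f 7, a \<cdot>\<^sub>v f 6, (-b) \<cdot>\<^sub>v f 5, (a*b) \<cdot>\<^sub>v f 4, c \<cdot>\<^sub>v f 3, (-(a*c)) \<cdot>\<^sub>v f 2, (b*c) \<cdot>\<^sub>v f 1, (a*b*c) \<cdot>\<^sub>v f 0]])"

definition octonion_algebra :: "'a::field \<Rightarrow> 'a \<Rightarrow> 'a \<Rightarrow> 'a vec ring" where
  "octonion_algebra a b c = table_algebra 8 (octonion_table a b c)"

definition varphi_mat :: "'a::field \<Rightarrow> 'a \<Rightarrow> 'a vec \<Rightarrow> 'a mat" where
  "varphi_mat a b q = mat_of_rows_list 4
    [[q$0, a * q$1, b * q$2, -(a*b) * q$3],
     [q$1, q$0, b * q$3, -b * q$2],
     [q$2, -a * q$3, q$0, a * q$1],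
     [q$3, - q$2, q$1, q$0]]"

definition rho_mat :: "'a::field \<Rightarrow> 'a \<Rightarrow> 'a vec \<Rightarrow> 'a mat" where
  "rho_mat a b q = mat_of_rows_list 4
    [[q$0, a * q$1, b * q$2, -(a*b) * q$3],
     [q$1, q$0, -b * q$3, b * q$2],
     [q$2, a * q$3, q$0, -a * q$1],
     [q$3, q$2, - q$1, q$0]]"

definition Phi_mat :: "'a::field \<Rightarrow> 'a \<Rightarrow> 'a \<Rightarrow> 'a vec \<Rightarrow> 'a mat" where
  "Phi_mat a b c x = mat_of_rows_list 8
    [[x$0, a * x$1, b * x$2, -(a*b) * x$3, c * x$4, -(a*c) * x$5, -(b*c) * x$6, (a*b*c) * x$7],
     [x$1, x$0, b * x$3, -b * x$2, c * x$5, -c * x$4, (b*c) * x$7, -(b*c) * x$6],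
     [x$2, -a * x$3, x$0, a * x$1, c * x$6, -(a*c) * x$7, -c * x$4, (a*c) * x$5],
     [x$3, - x$2, x$1, x$0, c * x$7, -c * x$6, c * x$5, -c * x$4],
     [x$4, -a * x$5, -b * x$6, (a*b) * x$7, x$0, a * x$1, b * x$2, -(a*b) * x$3],
     [x$5, - x$4, -b * x$7, b * x$6, x$1, x$0, -b * x$3, b * x$2],
     [x$6, a * x$7, - x$4, -a * x$5, x$2, a * x$3, x$0, -a * x$1],
     [x$7, x$6, - x$5, - x$4, x$3, x$2, - x$1, x$0]]"

definition Psi_mat :: "'a::field \<Rightarrow> 'a \<Rightarrow> 'a \<Rightarrow> 'a vec \<Rightarrow> 'a mat" where
  "Psi_mat a b c x = mat_of_rows_list 8
    [[x$0, a * x$1, b * x$2, -(a*b) * x$3, c * x$4, -(a*c) * x$5, -(b*c) * x$6, (a*b*c) * x$7],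
     [x$1, x$0, -b * x$3, b * x$2, -c * x$5, c * x$4, -(b*c) * x$7, (b*c) * x$6],
     [x$2, a * x$3, x$0, -a * x$1, -c * x$6, (a*c) * x$7, c * x$4, -(a*c) * x$5],
     [x$3, x$2, - x$1, x$0, -c * x$7, c * x$6, -c * x$5, c * x$4],
     [x$4, a * x$5, b * x$6, -(a*b) * x$7, x$0, -a * x$1, -b * x$2, (a*b) * x$3],
     [x$5, x$4, b * x$7, -b * x$6, - x$1, x$0, b * x$3, -b * x$2],
     [x$6, -a * x$7, x$4, a * x$5, - x$2, -a * x$3, x$0, a * x$1],
     [x$7, - x$6, x$5, x$4, - x$3, - x$2, x$1, x$0]]"

end

theory Submission
  imports Defs
begin

text \<open>
  Each of the four matrices represents left or right multiplication by \<open>x\<close>, and it satisfies the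
  same quadratic equation \<open>X\<^sup>2 = 2 x\<^sub>0 X - N(x)\<close> as \<open>x\<close> itself. Hence \<open>x\<^sup>m = \<alpha> x + \<beta>\<close> and
  \<open>\<epsilon>(x)\<^sup>m = \<alpha> \<epsilon>(x) + \<beta>\<close> with the same scalars, so that \<open>\<epsilon>(x\<^sup>m) = \<epsilon>(x)\<^sup>m\<close> even in the
  non-associative case. Finally \<open>\<epsilon>\<close> is injective, because its first column is \<open>x\<close>.
\<close>

text \<open>Compatibility with products is asked only for powers of \<open>x\<close>, which is all
  that a map out of a non-associative ring can offer here. Injectivity then gives
  \<open>E x [^] m = E x\<close> exactly when \<open>x [^] m = x\<close>, so the minimality of
  \<open>k\<close> carries over.\<close>

lemma k_potent_image:
  assumes "k_potent R k x"
    and "E x \<in> carrier S" and "inj_on E (carrier R)"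
    and pow: "\<And>m. x [^]\<^bsub>R\<^esub> (m::nat) \<in> carrier R" "\<And>m. E (x [^]\<^bsub>R\<^esub> (m::nat)) = E x [^]\<^bsub>S\<^esub> m"
  shows "k_potent S k (E x)"
  using assms unfolding k_potent_def by (metis inj_onD)

section \<open>Matrix-vector products and entries of matrix products\<close>

lemma mult_mat_unit_vec:
  fixes A :: "'a::semiring_1 mat"
  assumes "A \<in> carrier_mat m n" and "j < n"
  shows "A *\<^sub>v unit_vec n j = col A j"
  using assms by (intro eq_vecI) auto

lemma smult_mult_mat_vec:
  fixes A :: "'a::comm_semiring_0 mat"
  assumes "A \<in> carrier_mat m n" and "v \<in> carrier_vec n"
  shows "(r \<cdot>\<^sub>m A) *\<^sub>v v = r \<cdot>\<^sub>v (A *\<^sub>v v)"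
  using assms by (intro eq_vecI) (auto simp: scalar_prod_def sum_distrib_left mult.assoc)

lemma index_mult_mat_sum:
  assumes "A \<in> carrier_mat m n" and "B \<in> carrier_mat n p" and "i < m" and "j < p"
  shows "(A * B) $$ (i, j) = (\<Sum>l<n. A $$ (i, l) * B $$ (l, j))"
  using assms by (simp add: scalar_prod_def lessThan_atLeast0)

text \<open>With \<open>s i j\<close> the product of the basis vectors i and j, this is the matrix
  of left multiplication by \<open>x\<close>; with the two indices of the table swapped it is right
  multiplication. One definition thus serves all four matrices.\<close>

definition structure_mat :: "nat \<Rightarrow> (nat \<Rightarrow> nat \<Rightarrow> 'a::field vec) \<Rightarrow> 'a vec \<Rightarrow> 'a mat" where
  "structure_mat n s x = mat n n (\<lambda>(l, j). \<Sum>i<n. x $ i * s i j $ l)"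

text \<open>The basis vector 0 is a two-sided unit; the condition is symmetric in the indices, so it
  suits a table and its transpose alike.\<close>

definition unital_structure :: "nat \<Rightarrow> (nat \<Rightarrow> nat \<Rightarrow> 'a::field vec) \<Rightarrow> bool" where
  "unital_structure n s \<longleftrightarrow> (\<forall>i<n. s i 0 = unit_vec n i \<and> s 0 i = unit_vec n i)"

section \<open>Linearity, unit and first column of structure matrices\<close>

lemma structure_mat_carrier [simp]: "structure_mat n s x \<in> carrier_mat n n"
  by (simp add: structure_mat_def)

lemma structure_mat_dim [simp]:
  "dim_row (structure_mat n s x) = n" "dim_col (structure_mat n s x) = n"
  by (simp_all add: structure_mat_def)

lemma structure_mat_add:
  assumes "v \<in> carrier_vec n"
  shows "structure_mat n s (u + v) = structure_mat n s u + structure_mat n s v"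
  using assms by (intro eq_matI) (auto simp: structure_mat_def algebra_simps sum.distrib)

lemma structure_mat_smult:
  assumes "u \<in> carrier_vec n"
  shows "structure_mat n s (r \<cdot>\<^sub>v u) = r \<cdot>\<^sub>m structure_mat n s u"
  using assms by (intro eq_matI) (auto simp: structure_mat_def sum_distrib_left mult.assoc)

lemma structure_mat_unit:
  assumes "unital_structure n s"
  shows "structure_mat n s (unit_vec n 0) = 1\<^sub>m n"
proof (rule eq_matI)
  fix l j assume "l < dim_row (1\<^sub>m n :: 'a mat)" "j < dim_col (1\<^sub>m n :: 'a mat)"
  then have lj: "l < n" "j < n" by auto
  have "(\<Sum>i<n. unit_vec n 0 $ i * s i j $ l) = (\<Sum>i<n. if i = 0 then s i j $ l else 0)"
    by (intro sum.cong) auto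
  also have "\<dots> = s 0 j $ l" using lj by (simp add: sum.delta)
  finally show "structure_mat n s (unit_vec n 0) $$ (l, j) = 1\<^sub>m n $$ (l, j)"
    using assms lj by (auto simp: structure_mat_def unital_structure_def)
qed auto

text \<open>Column 0 is the product of \<open>v\<close> with the unit. This makes
  \<open>structure_mat n s\<close> injective on \<open>carrier_vec n\<close>.\<close>

lemma structure_mat_col_0:
  assumes "unital_structure n s" and "n > 0" and "v \<in> carrier_vec n"
  shows "col (structure_mat n s v) 0 = v"
proof (rule eq_vecI)
  fix l assume "l < dim_vec v"
  then have l: "l < n" using assms by auto
  have "(\<Sum>i<n. v $ i * s i 0 $ l) = (\<Sum>i<n. if i = l then v $ i else 0)"
    using assms(1) l by (intro sum.cong) (auto simp: unital_structure_def)
  also have "\<dots> = v $ l" using l by (simp add: sum.delta)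
  finally show "col (structure_mat n s v) 0 $ l = v $ l"
    using assms l by (simp add: structure_mat_def)
qed (use assms in auto)

text \<open>Powers are left-normed, so only products with \<open>x\<close> as right factor occur.
  The disjunction in \<open>mult\<close> covers left and right multiplication matrices at once: for
  \<open>y\<close> in the span of \<open>x\<close> and the unit both alternatives have the same
  value.\<close>

lemma k_potent_structure_mat:
  assumes R: "carrier R = carrier_vec n" "\<one>\<^bsub>R\<^esub> = unit_vec n 0"
    and s: "unital_structure n s" and "n > 0"
    and mult: "\<And>y. y \<in> carrier_vec n \<Longrightarrow>
      y \<otimes>\<^bsub>R\<^esub> x = structure_mat n s y *\<^sub>v x \<or> y \<otimes>\<^bsub>R\<^esub> x = structure_mat n s x *\<^sub>v y"
    and quad: "structure_mat n s x * structure_mat n s x = t \<cdot>\<^sub>m structure_mat n s x + d \<cdot>\<^sub>m 1\<^sub>m n"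
    and x: "k_potent R k x"
  shows "k_potent (ring_mat TYPE('a::field) n ()) k (structure_mat n s x)"
proof -
  let ?E = "structure_mat n s" and ?e = "unit_vec n 0 :: 'a vec"
  let ?S = "ring_mat TYPE('a) n ()"
  have xc: "x \<in> carrier_vec n" using x R by (simp add: k_potent_def)
  have E_lin: "?E (\<alpha> \<cdot>\<^sub>v x + \<beta> \<cdot>\<^sub>v ?e) = \<alpha> \<cdot>\<^sub>m ?E x + \<beta> \<cdot>\<^sub>m 1\<^sub>m n" for \<alpha> \<beta>
    using xc s by (simp add: structure_mat_add structure_mat_smult structure_mat_unit)
  have E_unit_vec: "?E x *\<^sub>v ?e = x"
    using structure_mat_col_0[OF s \<open>n > 0\<close> xc] \<open>n > 0\<close>
    by (simp add: mult_mat_unit_vec[of _ n n])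
  \<comment> \<open>The equation \<open>quad\<close> for the matrix, applied to the unit vector,
    becomes the quadratic equation for \<open>x\<close> itself.\<close>
  have xx: "?E x *\<^sub>v x = t \<cdot>\<^sub>v x + d \<cdot>\<^sub>v ?e"
  proof -
    have "?E x *\<^sub>v x = (?E x * ?E x) *\<^sub>v ?e"
      by (simp add: E_unit_vec assoc_mult_mat_vec[of _ n n _ n])
    also have "\<dots> = t \<cdot>\<^sub>v x + d \<cdot>\<^sub>v ?e"
      unfolding quad
      by (simp add: add_mult_distrib_mat_vec[of _ n n] smult_mult_mat_vec[of _ n n]
          E_unit_vec)
    finally show ?thesis .
  qed
  \<comment> \<open>Multiplication by \<open>x\<close> preserves the span of \<open>x\<close> and
    the unit, and both readings of the product are computed to agree there.\<close>
  have step: "(\<alpha> \<cdot>\<^sub>v x + \<beta> \<cdot>\<^sub>v ?e) \<otimes>\<^bsub>R\<^esub> x = (\<alpha> * t + \<beta>) \<cdot>\<^sub>v x + (\<alpha> * d) \<cdot>\<^sub>v ?e" for \<alpha> \<beta>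
  proof -
    have y: "\<alpha> \<cdot>\<^sub>v x + \<beta> \<cdot>\<^sub>v ?e \<in> carrier_vec n" using xc by auto
    have "?E (\<alpha> \<cdot>\<^sub>v x + \<beta> \<cdot>\<^sub>v ?e) *\<^sub>v x = \<alpha> \<cdot>\<^sub>v (?E x *\<^sub>v x) + \<beta> \<cdot>\<^sub>v x"
      using xc
      by (simp add: E_lin add_mult_distrib_mat_vec[of _ n n] smult_mult_mat_vec[of _ n n])
    moreover have "?E x *\<^sub>v (\<alpha> \<cdot>\<^sub>v x + \<beta> \<cdot>\<^sub>v ?e) = \<alpha> \<cdot>\<^sub>v (?E x *\<^sub>v x) + \<beta> \<cdot>\<^sub>v x"
      using xc
      by (simp add: mult_add_distrib_mat_vec[of _ n n] mult_mat_vec[of _ n n] E_unit_vec)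
    ultimately have "(\<alpha> \<cdot>\<^sub>v x + \<beta> \<cdot>\<^sub>v ?e) \<otimes>\<^bsub>R\<^esub> x = \<alpha> \<cdot>\<^sub>v (?E x *\<^sub>v x) + \<beta> \<cdot>\<^sub>v x"
      using mult[OF y] by auto
    also have "\<dots> = (\<alpha> * t + \<beta>) \<cdot>\<^sub>v x + (\<alpha> * d) \<cdot>\<^sub>v ?e"
      unfolding xx using xc by (intro eq_vecI) (auto simp: algebra_simps)
    finally show ?thesis .
  qed
  \<comment> \<open>The same pair of scalars must serve both powers. It starts at (0, 1), and each
    factor sends (\<alpha>, \<beta>) to (\<alpha> t + \<beta>, \<alpha> d) on both sides.\<close>
  have pow: "\<exists>\<alpha> \<beta>. x [^]\<^bsub>R\<^esub> m = \<alpha> \<cdot>\<^sub>v x + \<beta> \<cdot>\<^sub>v ?e \<and> ?E x [^]\<^bsub>?S\<^esub> m = \<alpha> \<cdot>\<^sub>m ?E x + \<beta> \<cdot>\<^sub>m 1\<^sub>m n"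
    for m :: nat
  proof (induction m)
    case 0
    have "?e = 0 \<cdot>\<^sub>v x + 1 \<cdot>\<^sub>v ?e" "1\<^sub>m n = 0 \<cdot>\<^sub>m ?E x + 1 \<cdot>\<^sub>m 1\<^sub>m n"
      using xc by auto
    then show ?case
      unfolding nat_pow_0 R ring_mat_def by (metis monoid.simps(2))
  next
    case (Suc m)
    then obtain \<alpha> \<beta> where IH: "x [^]\<^bsub>R\<^esub> m = \<alpha> \<cdot>\<^sub>v x + \<beta> \<cdot>\<^sub>v ?e"
      "?E x [^]\<^bsub>?S\<^esub> m = \<alpha> \<cdot>\<^sub>m ?E x + \<beta> \<cdot>\<^sub>m 1\<^sub>m n" by auto
    have "(\<alpha> \<cdot>\<^sub>m ?E x + \<beta> \<cdot>\<^sub>m 1\<^sub>m n) * ?E x = \<alpha> \<cdot>\<^sub>m (?E x * ?E x) + \<beta> \<cdot>\<^sub>m ?E x"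
      by (simp add: add_mult_distrib_mat[of _ n n _ _ n] mult_smult_assoc_mat[of _ n n _ n])
    also have "\<dots> = (\<alpha> * t + \<beta>) \<cdot>\<^sub>m ?E x + (\<alpha> * d) \<cdot>\<^sub>m 1\<^sub>m n"
      unfolding quad by (intro eq_matI) (auto simp: algebra_simps)
    finally have "?E x [^]\<^bsub>?S\<^esub> Suc m = (\<alpha> * t + \<beta>) \<cdot>\<^sub>m ?E x + (\<alpha> * d) \<cdot>\<^sub>m 1\<^sub>m n"
      using IH(2) by (simp add: ring_mat_def)
    moreover have "x [^]\<^bsub>R\<^esub> Suc m = (\<alpha> * t + \<beta>) \<cdot>\<^sub>v x + (\<alpha> * d) \<cdot>\<^sub>v ?e"
      using IH(1) step by simp
    ultimately show ?case by blast
  qed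
  show ?thesis
  proof (rule k_potent_image[OF x])
    show "?E x \<in> carrier ?S" by (simp add: ring_mat_def)
    show "inj_on ?E (carrier R)"
      using structure_mat_col_0[OF s \<open>n > 0\<close>] R(1) by (metis inj_onI)
    fix m :: nat
    obtain \<alpha> \<beta> where "x [^]\<^bsub>R\<^esub> m = \<alpha> \<cdot>\<^sub>v x + \<beta> \<cdot>\<^sub>v ?e"
      "?E x [^]\<^bsub>?S\<^esub> m = \<alpha> \<cdot>\<^sub>m ?E x + \<beta> \<cdot>\<^sub>m 1\<^sub>m n" using pow by blast
    then show "x [^]\<^bsub>R\<^esub> m \<in> carrier R" "?E (x [^]\<^bsub>R\<^esub> m) = ?E x [^]\<^bsub>?S\<^esub> m"
      using xc R(1) by (simp_all only: E_lin) auto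
  qed
qed

section \<open>Table algebras: products as matrix-vector products\<close>

lemma table_algebra_simps:
  "carrier (table_algebra n T) = carrier_vec n"
  "\<one>\<^bsub>table_algebra n T\<^esub> = unit_vec n 0"
  by (simp_all add: table_algebra_def)

lemma table_algebra_mult_left:
  assumes "y \<in> carrier_vec n"
  shows "x \<otimes>\<^bsub>table_algebra n T\<^esub> y = structure_mat n (\<lambda>i j. T ! i ! j) x *\<^sub>v y"
proof (rule eq_vecI)
  fix l assume "l < dim_vec (structure_mat n (\<lambda>i j. T ! i ! j) x *\<^sub>v y)"
  then have l: "l < n" by simp
  have "(\<Sum>i<n. \<Sum>j<n. x $ i * y $ j * (T ! i ! j) $ l)
      = (\<Sum>j<n. (\<Sum>i<n. x $ i * (T ! i ! j) $ l) * y $ j)"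
    by (subst sum.swap) (simp add: sum_distrib_left sum_distrib_right ac_simps)
  then show "(x \<otimes>\<^bsub>table_algebra n T\<^esub> y) $ l = (structure_mat n (\<lambda>i j. T ! i ! j) x *\<^sub>v y) $ l"
    using l assms
    by (simp add: table_algebra_def structure_mat_def scalar_prod_def lessThan_atLeast0)
qed (simp add: table_algebra_def)

text \<open>Swapping the indices of \<open>T\<close> gives the table of the opposite algebra, whose
  left multiplications are the right multiplications here.\<close>

lemma table_algebra_mult_right:
  assumes "x \<in> carrier_vec n"
  shows "x \<otimes>\<^bsub>table_algebra n T\<^esub> y = structure_mat n (\<lambda>i j. T ! j ! i) y *\<^sub>v x"
proof (rule eq_vecI)
  fix l assume "l < dim_vec (structure_mat n (\<lambda>i j. T ! j ! i) y *\<^sub>v x)"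
  then have l: "l < n" by simp
  have "(\<Sum>i<n. \<Sum>j<n. x $ i * y $ j * (T ! i ! j) $ l)
      = (\<Sum>i<n. (\<Sum>j<n. y $ j * (T ! i ! j) $ l) * x $ i)"
    by (simp add: sum_distrib_left sum_distrib_right ac_simps)
  then show "(x \<otimes>\<^bsub>table_algebra n T\<^esub> y) $ l = (structure_mat n (\<lambda>i j. T ! j ! i) y *\<^sub>v x) $ l"
    using l assms
    by (simp add: table_algebra_def structure_mat_def scalar_prod_def lessThan_atLeast0)
qed (simp add: table_algebra_def)

section \<open>The concrete matrices as multiplication matrices\<close>

lemma less_4_iff: "(i::nat) < 4 \<longleftrightarrow> i = 0 \<or> i = 1 \<or> i = 2 \<or> i = 3"
  by auto

lemma less_8_iff:
  "(i::nat) < 8 \<longleftrightarrow> i = 0 \<or> i = 1 \<or> i = 2 \<or> i = 3 \<or> i = 4 \<or> i = 5 \<or> i = 6 \<or> i = 7"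
  by auto

lemma sum_less_4: "(\<Sum>i<4. f i) = f 0 + f 1 + f 2 + f (3::nat)"
  for f :: "nat \<Rightarrow> 'a::comm_monoid_add"
  by (simp add: eval_nat_numeral)

lemma sum_less_8: "(\<Sum>i<8. f i) = f 0 + f 1 + f 2 + f 3 + f 4 + f 5 + f 6 + f (7::nat)"
  for f :: "nat \<Rightarrow> 'a::comm_monoid_add"
  by (simp add: eval_nat_numeral)

lemma unital_quaternion_table:
  "unital_structure 4 (\<lambda>i j. quaternion_table a b ! i ! j)"
  "unital_structure 4 (\<lambda>i j. quaternion_table a b ! j ! i)"
  by (auto simp: unital_structure_def less_4_iff quaternion_table_def Let_def)

lemma unital_octonion_table:
  "unital_structure 8 (\<lambda>i j. octonion_table a b c ! i ! j)"
  "unital_structure 8 (\<lambda>i j. octonion_table a b c ! j ! i)"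
  by (auto simp: unital_structure_def less_8_iff octonion_table_def Let_def)

text \<open>Column j of \<open>varphi_mat a b x\<close> holds the coordinates of x times the basis
  vector j, so this is left multiplication; the 16 entries are compared one by one.\<close>

lemma varphi_mat_structure:
  "varphi_mat a b x = structure_mat 4 (\<lambda>i j. quaternion_table a b ! i ! j) x"
proof (rule eq_matI)
  fix l j
  assume "l < dim_row (structure_mat 4 (\<lambda>i j. quaternion_table a b ! i ! j) x)"
    and "j < dim_col (structure_mat 4 (\<lambda>i j. quaternion_table a b ! i ! j) x)"
  then have "l < 4" "j < 4" by auto
  then show "varphi_mat a b x $$ (l, j)
      = structure_mat 4 (\<lambda>i j. quaternion_table a b ! i ! j) x $$ (l, j)"
    unfolding structure_mat_def varphi_mat_def mat_of_rows_list_def quaternion_table_def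
      Let_def less_4_iff
    by (elim disjE) (simp_all add: sum_less_4)
qed (simp_all add: varphi_mat_def mat_of_rows_list_def)

text \<open>Here column j is the basis vector j times x, hence the swapped indices.\<close>

lemma rho_mat_structure:
  "rho_mat a b x = structure_mat 4 (\<lambda>i j. quaternion_table a b ! j ! i) x"
proof (rule eq_matI)
  fix l j
  assume "l < dim_row (structure_mat 4 (\<lambda>i j. quaternion_table a b ! j ! i) x)"
    and "j < dim_col (structure_mat 4 (\<lambda>i j. quaternion_table a b ! j ! i) x)"
  then have "l < 4" "j < 4" by auto
  then show "rho_mat a b x $$ (l, j)
      = structure_mat 4 (\<lambda>i j. quaternion_table a b ! j ! i) x $$ (l, j)"
    unfolding structure_mat_def rho_mat_def mat_of_rows_list_def quaternion_table_def
      Let_def less_4_iff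
    by (elim disjE) (simp_all add: sum_less_4)
qed (simp_all add: rho_mat_def mat_of_rows_list_def)

lemma Phi_mat_structure:
  "Phi_mat a b c x = structure_mat 8 (\<lambda>i j. octonion_table a b c ! i ! j) x"
proof (rule eq_matI)
  fix l j
  assume "l < dim_row (structure_mat 8 (\<lambda>i j. octonion_table a b c ! i ! j) x)"
    and "j < dim_col (structure_mat 8 (\<lambda>i j. octonion_table a b c ! i ! j) x)"
  then have "l < 8" "j < 8" by auto
  then show "Phi_mat a b c x $$ (l, j)
      = structure_mat 8 (\<lambda>i j. octonion_table a b c ! i ! j) x $$ (l, j)"
    unfolding structure_mat_def Phi_mat_def mat_of_rows_list_def octonion_table_def
      Let_def less_8_iff
    by (elim disjE) (simp_all add: sum_less_8)
qed (simp_all add: Phi_mat_def mat_of_rows_list_def)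

lemma Psi_mat_structure:
  "Psi_mat a b c x = structure_mat 8 (\<lambda>i j. octonion_table a b c ! j ! i) x"
proof (rule eq_matI)
  fix l j
  assume "l < dim_row (structure_mat 8 (\<lambda>i j. octonion_table a b c ! j ! i) x)"
    and "j < dim_col (structure_mat 8 (\<lambda>i j. octonion_table a b c ! j ! i) x)"
  then have "l < 8" "j < 8" by auto
  then show "Psi_mat a b c x $$ (l, j)
      = structure_mat 8 (\<lambda>i j. octonion_table a b c ! j ! i) x $$ (l, j)"
    unfolding structure_mat_def Psi_mat_def mat_of_rows_list_def octonion_table_def
      Let_def less_8_iff
    by (elim disjE) (simp_all add: sum_less_8)
qed (simp_all add: Psi_mat_def mat_of_rows_list_def)

section \<open>The quadratic equation of each matrix\<close>

lemma varphi_mat_square: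
  "varphi_mat a b x * varphi_mat a b x = (2 * x $ 0) \<cdot>\<^sub>m varphi_mat a b x
    + (a * x $ 1 ^ 2 + b * x $ 2 ^ 2 - a * b * x $ 3 ^ 2 - x $ 0 ^ 2) \<cdot>\<^sub>m 1\<^sub>m 4"
  (is "?A * ?A = ?R")
proof (rule eq_matI)
  fix l j assume "l < dim_row ?R" and "j < dim_col ?R"
  then have lj: "l < 4" "j < 4" by auto
  have "(?A * ?A) $$ (l, j) = (\<Sum>i<4. ?A $$ (l, i) * ?A $$ (i, j))"
    by (rule index_mult_mat_sum) (use lj in \<open>simp_all add: varphi_mat_structure\<close>)
  \<comment> \<open>The scalar coefficient in \<open>?R\<close> is minus the norm form of x and
    \<open>2 * x $ 0\<close> is the trace; each entry is a polynomial identity in the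
    coordinates.\<close>
  also have "\<dots> = ?R $$ (l, j)"
    using lj unfolding varphi_mat_def mat_of_rows_list_def less_4_iff sum_less_4
    by (elim disjE) (simp_all add: algebra_simps power2_eq_square)
  finally show "(?A * ?A) $$ (l, j) = ?R $$ (l, j)" .
qed (simp_all add: varphi_mat_structure)

lemma rho_mat_square:
  "rho_mat a b x * rho_mat a b x = (2 * x $ 0) \<cdot>\<^sub>m rho_mat a b x
    + (a * x $ 1 ^ 2 + b * x $ 2 ^ 2 - a * b * x $ 3 ^ 2 - x $ 0 ^ 2) \<cdot>\<^sub>m 1\<^sub>m 4"
  (is "?A * ?A = ?R")
proof (rule eq_matI)
  fix l j assume "l < dim_row ?R" and "j < dim_col ?R"
  then have lj: "l < 4" "j < 4" by auto
  have "(?A * ?A) $$ (l, j) = (\<Sum>i<4. ?A $$ (l, i) * ?A $$ (i, j))"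
    by (rule index_mult_mat_sum) (use lj in \<open>simp_all add: rho_mat_structure\<close>)
  also have "\<dots> = ?R $$ (l, j)"
    using lj unfolding rho_mat_def mat_of_rows_list_def less_4_iff sum_less_4
    by (elim disjE) (simp_all add: algebra_simps power2_eq_square)
  finally show "(?A * ?A) $$ (l, j) = ?R $$ (l, j)" .
qed (simp_all add: rho_mat_structure)

text \<open>Conceptually this is left alternativity, x (x y) = (x x) y, combined with the quadratic
  equation of x. The proof checks the 64 entries directly.\<close>

lemma Phi_mat_square:
  "Phi_mat a b c x * Phi_mat a b c x = (2 * x $ 0) \<cdot>\<^sub>m Phi_mat a b c x
    + (a * x $ 1 ^ 2 + b * x $ 2 ^ 2 - a * b * x $ 3 ^ 2 + c * x $ 4 ^ 2
      - a * c * x $ 5 ^ 2 - b * c * x $ 6 ^ 2 + a * b * c * x $ 7 ^ 2 - x $ 0 ^ 2) \<cdot>\<^sub>m 1\<^sub>m 8"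
  (is "?A * ?A = ?R")
proof (rule eq_matI)
  fix l j assume "l < dim_row ?R" and "j < dim_col ?R"
  then have lj: "l < 8" "j < 8" by auto
  have "(?A * ?A) $$ (l, j) = (\<Sum>i<8. ?A $$ (l, i) * ?A $$ (i, j))"
    by (rule index_mult_mat_sum) (use lj in \<open>simp_all add: Phi_mat_structure\<close>)
  also have "\<dots> = ?R $$ (l, j)"
    using lj unfolding Phi_mat_def mat_of_rows_list_def less_8_iff sum_less_8
    by (elim disjE) (simp_all add: algebra_simps power2_eq_square)
  finally show "(?A * ?A) $$ (l, j) = ?R $$ (l, j)" .
qed (simp_all add: Phi_mat_structure)

text \<open>The counterpart for right alternativity, (y x) x = y (x x), again checked entry by
  entry.\<close>

lemma Psi_mat_square:
  "Psi_mat a b c x * Psi_mat a b c x = (2 * x $ 0) \<cdot>\<^sub>m Psi_mat a b c x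
    + (a * x $ 1 ^ 2 + b * x $ 2 ^ 2 - a * b * x $ 3 ^ 2 + c * x $ 4 ^ 2
      - a * c * x $ 5 ^ 2 - b * c * x $ 6 ^ 2 + a * b * c * x $ 7 ^ 2 - x $ 0 ^ 2) \<cdot>\<^sub>m 1\<^sub>m 8"
  (is "?A * ?A = ?R")
proof (rule eq_matI)
  fix l j assume "l < dim_row ?R" and "j < dim_col ?R"
  then have lj: "l < 8" "j < 8" by auto
  have "(?A * ?A) $$ (l, j) = (\<Sum>i<8. ?A $$ (l, i) * ?A $$ (i, j))"
    by (rule index_mult_mat_sum) (use lj in \<open>simp_all add: Psi_mat_structure\<close>)
  also have "\<dots> = ?R $$ (l, j)"
    using lj unfolding Psi_mat_def mat_of_rows_list_def less_8_iff sum_less_8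
    by (elim disjE) (simp_all add: algebra_simps power2_eq_square)
  finally show "(?A * ?A) $$ (l, j) = ?R $$ (l, j)" .
qed (simp_all add: Psi_mat_structure)

text \<open>Specializes the general criterion: \<open>s_cases\<close> chooses between left and right
  multiplication and so supplies the required disjunction on products.\<close>

lemma k_potent_table_algebra:
  fixes T :: "'a::field vec list list"
  assumes "n > 0" and x: "k_potent (table_algebra n T) k x"
    and s: "unital_structure n s" and s_cases: "s = (\<lambda>i j. T ! i ! j) \<or> s = (\<lambda>i j. T ! j ! i)"
    and quad: "structure_mat n s x * structure_mat n s x = t \<cdot>\<^sub>m structure_mat n s x + d \<cdot>\<^sub>m 1\<^sub>m n"
  shows "k_potent (ring_mat TYPE('a) n ()) k (structure_mat n s x)"
proof (rule k_potent_structure_mat[OF table_algebra_simps s \<open>n > 0\<close> _ quad x])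
  have "x \<in> carrier_vec n"
    using x by (simp add: k_potent_def table_algebra_simps)
  then show "y \<otimes>\<^bsub>table_algebra n T\<^esub> x = structure_mat n s y *\<^sub>v x
      \<or> y \<otimes>\<^bsub>table_algebra n T\<^esub> x = structure_mat n s x *\<^sub>v y"
    if "y \<in> carrier_vec n" for y
    using s_cases table_algebra_mult_left table_algebra_mult_right that by metis
qed

theorem mainTheorem2:
  fixes a b c :: "'a::field" and k :: nat
  assumes "CHAR('a) \<noteq> 2" and "k > 1"
  shows "(\<forall>x. k_potent (quaternion_algebra a b) k x \<longrightarrow>
            (\<forall>\<epsilon>\<in>{varphi_mat a b, rho_mat a b}. k_potent (ring_mat TYPE('a) 4 ()) k (\<epsilon> x)))
       \<and> (\<forall>x. k_potent (octonion_algebra a b c) k x \<longrightarrow>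
            (\<forall>\<epsilon>\<in>{Phi_mat a b c, Psi_mat a b c}. k_potent (ring_mat TYPE('a) 8 ()) k (\<epsilon> x)))"
\<comment> \<open>Splitting the membership of \<epsilon> in the two sets leaves one goal for each of
  the four matrices.\<close>
proof (intro conjI allI impI ballI; elim insertE emptyE; simp only:)
  show "k_potent (ring_mat TYPE('a) 4 ()) k (varphi_mat a b x)"
    if "k_potent (quaternion_algebra a b) k x" for x
    \<comment> \<open>Unfolding \<open>varphi_mat_structure\<close> turns the square identity into
      the premise \<open>quad\<close>, with the trace as \<open>t\<close> and minus the norm as
      \<open>d\<close>.\<close>
    using k_potent_table_algebra[OF _ that[unfolded quaternion_algebra_def]
        unital_quaternion_table(1) _ varphi_mat_square[unfolded varphi_mat_structure]]
    by (simp add: varphi_mat_structure)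
  show "k_potent (ring_mat TYPE('a) 4 ()) k (rho_mat a b x)"
    if "k_potent (quaternion_algebra a b) k x" for x
    using k_potent_table_algebra[OF _ that[unfolded quaternion_algebra_def]
        unital_quaternion_table(2) _ rho_mat_square[unfolded rho_mat_structure]]
    by (simp add: rho_mat_structure)
  show "k_potent (ring_mat TYPE('a) 8 ()) k (Phi_mat a b c x)"
    if "k_potent (octonion_algebra a b c) k x" for x
    using k_potent_table_algebra[OF _ that[unfolded octonion_algebra_def]
        unital_octonion_table(1) _ Phi_mat_square[unfolded Phi_mat_structure]]
    by (simp add: Phi_mat_structure)
  show "k_potent (ring_mat TYPE('a) 8 ()) k (Psi_mat a b c x)"
    if "k_potent (octonion_algebra a b c) k x" for x
    using k_potent_table_algebra[OF _ that[unfolded octonion_algebra_def]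
        unital_octonion_table(2) _ Psi_mat_square[unfolded Psi_mat_structure]]
    by (simp add: Psi_mat_structure)
qed

end
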